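(* Let $X=\mathbb C$ with the usual metric and the marked point $0$, and let $\tilde r=\{r_n\}_{n\in\mathbb N}$ be a normalizing sequence. Let $\tilde X_{0,\tilde r}$ be a maximal self-stable family with the corresponding pretangent space $\Omega_{0,\tilde r}$. Then $\Omega_{0,\tilde r}$ is tangent and isometric to $\mathbb C$.
   Context: Pretangent and tangent spaces. Let $(X,d)$ be a metric space with a marked point $a\in X$ (here $a=0$). A normalizing sequence is a sequence $\tilde r=\{r_n\}_{n\in\mathbb N}$ of positive reals with $r_n\to0$. $\tilde X$ is the set of all sequences of points of $X$. Sequences $\tilde x=\{x_n\},\tilde y=\{y_n\}\in\tilde X$ are mutually stable w.r.t. $\tilde r$ if the finite limit $\tilde d_{\tilde r}(\tilde x,\tilde y)=\tilde d(\tilde x,\tilde y):=\lim_{n\to\infty} d(x_n,y_n)/r_n$ exists. A family $\tilde F\subseteq\tilde X$ is self-stable (w.r.t. $\tilde r$) if every two of its elements are mutually stable; it is maximal self-stable if it is self-stable and every $\tilde z\in\tilde X$ either belongs to $\tilde F$ or is not mutually stable with some $\tilde x\in\tilde F$. Write $\tilde a=(a,a,\dots)$. $\tilde X_{a,\tilde r}$ denotes a maximal self-stable (w.r.t. $\tilde r$) family containing $\tilde a$; $\tilde d$ is a pseudometric on it. The metric identification of $(\tilde X_{a,\tilde r},\tilde d)$ (the quotient by $\tilde d(\tilde x,\tilde y)=0$ with the induced metric) is denoted $\Omega_{a,\tilde r}$ and called the pretangent space corresponding to $\tilde X_{a,\tilde r}$. An isometry is a distance-preserving surjection. For a subsequence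 $\tilde r'=\{r_{n_k}\}_k$ of $\tilde r$ ($n_k$ strictly increasing) and $\tilde x\in\tilde X$ put $\tilde x'=\{x_{n_k}\}_k$. There is a maximal self-stable (w.r.t. $\tilde r'$) family $\tilde X_{a,\tilde r'}\supseteq\{\tilde x':\tilde x\in\tilde X_{a,\tilde r}\}$, and $\tilde x\mapsto\tilde x'$ induces a distance-preserving map $em':\Omega_{a,\tilde r}\to\Omega_{a,\tilde r'}$, where $\Omega_{a,\tilde r'}$ is the metric identification of $\tilde X_{a,\tilde r'}$. The pretangent space $\Omega_{a,\tilde r}$ is tangent if $em'$ is an isometry for every subsequence $\tilde r'$ (this does not depend on the choice of $\tilde X_{a,\tilde r'}$). *)

theory Defs
  imports "HOL-Analysis.Analysis"
begin

definition normalizing_seq :: "(nat \<Rightarrow> real) \<Rightarrow> bool" where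
  "normalizing_seq r \<longleftrightarrow> (\<forall>n. 0 < r n) \<and> r \<longlonglongrightarrow> 0"

definition mutually_stable ::
    "(nat \<Rightarrow> real) \<Rightarrow> (nat \<Rightarrow> 'a::metric_space) \<Rightarrow> (nat \<Rightarrow> 'a) \<Rightarrow> bool" where
  "mutually_stable r x y \<longleftrightarrow> convergent (\<lambda>n. dist (x n) (y n) / r n)"

definition lim_dist ::
    "(nat \<Rightarrow> real) \<Rightarrow> (nat \<Rightarrow> 'a::metric_space) \<Rightarrow> (nat \<Rightarrow> 'a) \<Rightarrow> real" where
  "lim_dist r x y = lim (\<lambda>n. dist (x n) (y n) / r n)"

definition self_stable :: "(nat \<Rightarrow> real) \<Rightarrow> (nat \<Rightarrow> 'a::metric_space) set \<Rightarrow> bool" where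
  "self_stable r F \<longleftrightarrow> (\<forall>x\<in>F. \<forall>y\<in>F. mutually_stable r x y)"

definition maximal_self_stable :: "(nat \<Rightarrow> real) \<Rightarrow> (nat \<Rightarrow> 'a::metric_space) set \<Rightarrow> bool" where
  "maximal_self_stable r F \<longleftrightarrow>
     self_stable r F \<and> (\<forall>z. z \<in> F \<or> (\<exists>x\<in>F. \<not> mutually_stable r z x))"

text \<open>The families written \<open>X\<close> with subscripts \<open>a\<close>, \<open>r\<close> in the literature.\<close>

definition max_stable_family ::
    "'a::metric_space \<Rightarrow> (nat \<Rightarrow> real) \<Rightarrow> (nat \<Rightarrow> 'a) set \<Rightarrow> bool" where
  "max_stable_family a r F \<longleftrightarrow> maximal_self_stable r F \<and> (\<lambda>_. a) \<in> F"

definition zero_dist_rel ::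
    "(nat \<Rightarrow> real) \<Rightarrow> (nat \<Rightarrow> 'a::metric_space) set \<Rightarrow> ((nat \<Rightarrow> 'a) \<times> (nat \<Rightarrow> 'a)) set" where
  "zero_dist_rel r F = {(x, y). x \<in> F \<and> y \<in> F \<and> lim_dist r x y = 0}"

definition pretangent ::
    "(nat \<Rightarrow> real) \<Rightarrow> (nat \<Rightarrow> 'a::metric_space) set \<Rightarrow> (nat \<Rightarrow> 'a) set set" where
  "pretangent r F = F // zero_dist_rel r F"

text \<open>The induced metric on the quotient is evaluated at chosen representatives; by
  \<open>pretangent_dist_class\<close> below the choice is immaterial.\<close>

definition pretangent_dist ::
    "(nat \<Rightarrow> real) \<Rightarrow> (nat \<Rightarrow> 'a::metric_space) set \<Rightarrow> (nat \<Rightarrow> 'a) set \<Rightarrow> real" where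
  "pretangent_dist r A B = lim_dist r (SOME x. x \<in> A) (SOME y. y \<in> B)"

definition isometry_between ::
    "'a set \<Rightarrow> ('a \<Rightarrow> 'a \<Rightarrow> real) \<Rightarrow> 'b set \<Rightarrow> ('b \<Rightarrow> 'b \<Rightarrow> real) \<Rightarrow> ('a \<Rightarrow> 'b) \<Rightarrow> bool" where
  "isometry_between M d N e f \<longleftrightarrow>
     f ` M = N \<and> (\<forall>x\<in>M. \<forall>y\<in>M. e (f x) (f y) = d x y)"

definition isometric_spaces ::
    "'a set \<Rightarrow> ('a \<Rightarrow> 'a \<Rightarrow> real) \<Rightarrow> 'b set \<Rightarrow> ('b \<Rightarrow> 'b \<Rightarrow> real) \<Rightarrow> bool" where
  "isometric_spaces M d N e \<longleftrightarrow> (\<exists>f. isometry_between M d N e f)"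

text \<open>With \<open>r' = r \<circ> s\<close> and \<open>F'\<close> a family containing all \<open>x \<circ> s\<close>, \<open>x \<in> F\<close>, the map
  \<open>subseq_map r' F' s\<close> sends the class of \<open>x\<close> to the class of \<open>x \<circ> s\<close>; see
  \<open>subseq_map_class\<close> below.\<close>

definition subseq_map ::
    "(nat \<Rightarrow> real) \<Rightarrow> (nat \<Rightarrow> 'a::metric_space) set \<Rightarrow> (nat \<Rightarrow> nat) \<Rightarrow>
     (nat \<Rightarrow> 'a) set \<Rightarrow> (nat \<Rightarrow> 'a) set" where
  "subseq_map r' F' s A = zero_dist_rel r' F' `` ((\<lambda>x. x \<circ> s) ` A)"

text \<open>The property depends on the family \<open>F\<close>, from which the pretangent space is built. Its extension
  \<open>F'\<close> is universally quantified; one always exists, see \<open>max_stable_family_extension\<close> below.\<close>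

definition tangent :: "'a::metric_space \<Rightarrow> (nat \<Rightarrow> real) \<Rightarrow> (nat \<Rightarrow> 'a) set \<Rightarrow> bool" where
  "tangent a r F \<longleftrightarrow>
     (\<forall>s F'. strict_mono s \<longrightarrow> max_stable_family a (r \<circ> s) F' \<longrightarrow> (\<lambda>x. x \<circ> s) ` F \<subseteq> F' \<longrightarrow>
        isometry_between (pretangent r F) (pretangent_dist r)
          (pretangent (r \<circ> s) F') (pretangent_dist (r \<circ> s)) (subseq_map (r \<circ> s) F' s))"

lemma lim_dist_LIMSEQ:
  "mutually_stable r x y \<Longrightarrow> (\<lambda>n. dist (x n) (y n) / r n) \<longlonglongrightarrow> lim_dist r x y"
  unfolding mutually_stable_def lim_dist_def by (simp add: convergent_LIMSEQ_iff)

lemma lim_dist_self [simp]: "lim_dist r x x = 0"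
  by (simp add: lim_dist_def)

lemma lim_dist_commute: "lim_dist r x y = lim_dist r y x"
  by (simp add: lim_dist_def dist_commute)

lemma lim_dist_nonneg:
  assumes "normalizing_seq r" "mutually_stable r x y"
  shows "0 \<le> lim_dist r x y"
proof (rule LIMSEQ_le_const[OF lim_dist_LIMSEQ[OF assms(2)]])
  have "r n > 0" for n using assms(1) by (simp add: normalizing_seq_def)
  then show "\<exists>N. \<forall>n\<ge>N. 0 \<le> dist (x n) (y n) / r n" by (simp add: less_imp_le)
qed

lemma lim_dist_triangle:
  assumes "normalizing_seq r"
    and "mutually_stable r x y" "mutually_stable r y z" "mutually_stable r x z"
  shows "lim_dist r x z \<le> lim_dist r x y + lim_dist r y z"
proof (rule LIMSEQ_le[OF lim_dist_LIMSEQ[OF assms(4)]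
      tendsto_add[OF lim_dist_LIMSEQ[OF assms(2)] lim_dist_LIMSEQ[OF assms(3)]]])
  have pos: "r n > 0" for n using assms(1) by (simp add: normalizing_seq_def)
  have "dist (x n) (z n) / r n \<le> dist (x n) (y n) / r n + dist (y n) (z n) / r n" for n
    using dist_triangle[of "x n" "z n" "y n"] pos[of n]
    by (simp add: divide_right_mono flip: add_divide_distrib)
  then show "\<exists>N. \<forall>n\<ge>N. dist (x n) (z n) / r n \<le> dist (x n) (y n) / r n + dist (y n) (z n) / r n"
    by blast
qed

lemma equiv_zero_dist_rel:
  assumes "normalizing_seq r" "self_stable r F"
  shows "equiv F (zero_dist_rel r F)"
proof (rule equivI)
  show "zero_dist_rel r F \<subseteq> F \<times> F" "refl_on F (zero_dist_rel r F)"
    by (auto simp: zero_dist_rel_def refl_on_def)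
  show "sym (zero_dist_rel r F)"
    by (auto simp: zero_dist_rel_def sym_def lim_dist_commute)
  show "trans (zero_dist_rel r F)"
  proof (rule transI)
    fix x y z assume "(x, y) \<in> zero_dist_rel r F" "(y, z) \<in> zero_dist_rel r F"
    then have F: "x \<in> F" "y \<in> F" "z \<in> F" and 0: "lim_dist r x y = 0" "lim_dist r y z = 0"
      by (auto simp: zero_dist_rel_def)
    have st: "mutually_stable r x y" "mutually_stable r y z" "mutually_stable r x z"
      using assms(2) F by (auto simp: self_stable_def)
    have "lim_dist r x z = 0"
      using lim_dist_triangle[OF assms(1) st] lim_dist_nonneg[OF assms(1) st(3)] 0 by simp
    then show "(x, z) \<in> zero_dist_rel r F" using F by (simp add: zero_dist_rel_def)
  qed
qed

lemma lim_dist_cong: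
  assumes r: "normalizing_seq r" and F: "self_stable r F"
    and x: "(x, x') \<in> zero_dist_rel r F" and y: "(y, y') \<in> zero_dist_rel r F"
  shows "lim_dist r x y = lim_dist r x' y'"
proof -
  have mem: "x \<in> F" "x' \<in> F" "y \<in> F" "y' \<in> F"
    and 0: "lim_dist r x x' = 0" "lim_dist r y y' = 0"
    using x y by (auto simp: zero_dist_rel_def)
  have tri: "lim_dist r u w \<le> lim_dist r u v + lim_dist r v w"
    if "u \<in> F" "v \<in> F" "w \<in> F" for u v w
    using F that by (intro lim_dist_triangle[OF r]) (auto simp: self_stable_def)
  show ?thesis
    using tri[of x x' y] tri[of x' y' y] tri[of x' x y'] tri[of x y y'] mem 0
    by (simp add: lim_dist_commute)
qed

lemma pretangent_dist_class:
  assumes r: "normalizing_seq r" and F: "self_stable r F"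
    and A: "A \<in> pretangent r F" "x \<in> A" and B: "B \<in> pretangent r F" "y \<in> B"
  shows "pretangent_dist r A B = lim_dist r x y"
proof -
  have eq: "equiv F (zero_dist_rel r F)" by (rule equiv_zero_dist_rel[OF r F])
  have "(SOME x. x \<in> A) \<in> A" "(SOME y. y \<in> B) \<in> B"
    using someI[of "\<lambda>x. x \<in> A"] someI[of "\<lambda>y. y \<in> B"] A(2) B(2) by blast+
  then have "((SOME x. x \<in> A), x) \<in> zero_dist_rel r F" "((SOME y. y \<in> B), y) \<in> zero_dist_rel r F"
    using quotient_eq_iff[OF eq] A B unfolding pretangent_def by blast+
  then show ?thesis
    unfolding pretangent_dist_def by (rule lim_dist_cong[OF r F])
qed

lemma normalizing_seq_subseq:
  "normalizing_seq r \<Longrightarrow> strict_mono s \<Longrightarrow> normalizing_seq (r \<circ> s)"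
  by (simp add: normalizing_seq_def LIMSEQ_subseq_LIMSEQ)

lemma mutually_stable_subseq:
  assumes "mutually_stable r x y" "strict_mono s"
  shows "mutually_stable (r \<circ> s) (x \<circ> s) (y \<circ> s)"
  using convergent_subseq_convergent[of "\<lambda>n. dist (x n) (y n) / r n" s] assms
  by (simp add: mutually_stable_def o_def)

lemma lim_dist_subseq:
  assumes "mutually_stable r x y" "strict_mono s"
  shows "lim_dist (r \<circ> s) (x \<circ> s) (y \<circ> s) = lim_dist r x y"
  using LIMSEQ_subseq_LIMSEQ[OF lim_dist_LIMSEQ[OF assms(1)] assms(2)]
  by (simp add: lim_dist_def o_def limI)

lemma subseq_map_class:
  assumes r: "normalizing_seq r" and s: "strict_mono s"
    and F: "self_stable r F" and F': "self_stable (r \<circ> s) F'"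
    and sub: "(\<lambda>x. x \<circ> s) ` F \<subseteq> F'" and x: "x \<in> F"
  shows "subseq_map (r \<circ> s) F' s (zero_dist_rel r F `` {x}) = zero_dist_rel (r \<circ> s) F' `` {x \<circ> s}"
proof -
  have eq: "equiv F' (zero_dist_rel (r \<circ> s) F')"
    by (rule equiv_zero_dist_rel[OF normalizing_seq_subseq[OF r s] F'])
  have "zero_dist_rel (r \<circ> s) F' `` {y \<circ> s} = zero_dist_rel (r \<circ> s) F' `` {x \<circ> s}"
    if "(x, y) \<in> zero_dist_rel r F" for y
  proof -
    have "(x \<circ> s, y \<circ> s) \<in> zero_dist_rel (r \<circ> s) F'"
      using that F sub lim_dist_subseq[OF _ s, of r x y]
      by (auto simp: zero_dist_rel_def self_stable_def)
    then show ?thesis using equiv_class_eq[OF eq] by metis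
  qed
  moreover have "(x, x) \<in> zero_dist_rel r F" using x by (simp add: zero_dist_rel_def)
  ultimately show ?thesis unfolding subseq_map_def by blast
qed

lemma maximal_self_stable_extension:
  assumes "self_stable r F"
  shows "\<exists>F'. maximal_self_stable r F' \<and> F \<subseteq> F'"
proof -
  have sym: "mutually_stable r x y \<longleftrightarrow> mutually_stable r y x" for x y :: "nat \<Rightarrow> 'a"
    by (simp add: mutually_stable_def dist_commute)
  let ?S = "{G. self_stable r G \<and> F \<subseteq> G}"
  have "\<exists>M\<in>?S. \<forall>G\<in>?S. M \<subseteq> G \<longrightarrow> G = M"
  proof (rule subset_Zorn_nonempty)
    show "?S \<noteq> {}" using assms by blast
    fix C assume "C \<noteq> {}" and C: "subset.chain ?S C"
    have "mutually_stable r x y" if x: "x \<in> \<Union>C" and y: "y \<in> \<Union>C" for x y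
    proof -
      obtain G where "G \<in> C" "x \<in> G" using x by blast
      moreover obtain H where "H \<in> C" "y \<in> H" using y by blast
      moreover from calculation have "G \<subseteq> H \<or> H \<subseteq> G" "self_stable r G" "self_stable r H"
        using C by (auto simp: subset_chain_def)
      ultimately show ?thesis unfolding self_stable_def by blast
    qed
    moreover have "F \<subseteq> \<Union>C" using C \<open>C \<noteq> {}\<close> unfolding subset_chain_def by blast
    ultimately show "\<Union>C \<in> ?S" by (simp add: self_stable_def)
  qed
  then obtain M where M: "self_stable r M" "F \<subseteq> M"
    and max: "\<And>G. self_stable r G \<Longrightarrow> F \<subseteq> G \<Longrightarrow> M \<subseteq> G \<Longrightarrow> G = M" by auto
  have "z \<in> M" if "\<forall>x\<in>M. mutually_stable r z x" for z
  proof -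
    have "mutually_stable r z z" by (simp add: mutually_stable_def convergent_const)
    then have "self_stable r (insert z M)"
      using M(1) that sym by (auto simp: self_stable_def)
    then show ?thesis using max[of "insert z M"] M(2) by blast
  qed
  then show ?thesis using M by (auto simp: maximal_self_stable_def)
qed

lemma max_stable_family_extension:
  assumes "max_stable_family a r F" "strict_mono s"
  shows "\<exists>F'. max_stable_family a (r \<circ> s) F' \<and> (\<lambda>x. x \<circ> s) ` F \<subseteq> F'"
proof -
  have "self_stable (r \<circ> s) ((\<lambda>x. x \<circ> s) ` F)"
    using assms
    by (auto simp: max_stable_family_def maximal_self_stable_def self_stable_def
        intro!: mutually_stable_subseq)
  then obtain F' where "maximal_self_stable (r \<circ> s) F'" "(\<lambda>x. x \<circ> s) ` F \<subseteq> F'"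
    using maximal_self_stable_extension by blast
  moreover have "(\<lambda>_. a) \<circ> s \<in> (\<lambda>x. x \<circ> s) ` F"
    using assms(1) unfolding max_stable_family_def by blast
  ultimately show ?thesis by (auto simp: max_stable_family_def o_def)
qed

end

theory Submission
  imports Defs
begin

text \<open>
  After division by \<open>r n\<close>, a self-stable family in \<open>\<complex>\<close> is a family of sequences whose mutual
  distances converge, although the sequences themselves may keep rotating and flipping. The point of
  the proof is that all members of a maximal family rotate and flip together: there are similarities
  \<open>T n\<close> of the plane with ratio \<open>1 / r n\<close> such that the family consists of exactly those \<open>x\<close> for
  which \<open>T n (x n)\<close> converges (\<open>maximal_family_has_convergence_charts\<close>).

  To find them, note that by polarization the rescaled inner products of members converge as well
  (\<open>stable_family_inner_convergent\<close>). Maximality guarantees that no direction is missed: for any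
  unit vectors \<open>p n\<close>, some member has a component along \<open>p n\<close> that does not vanish in the limit,
  since otherwise the sequence \<open>r n *\<^sub>R p n\<close> could be added to the family
  (\<open>maximal_family_meets_direction\<close>). A member with nonzero limit modulus determines directions
  \<open>w n\<close>; a second one that is not asymptotically parallel to \<open>w n\<close> determines the signs of the
  normals \<open>\<plusminus> \<i> * w n\<close>. In the orthonormal frames so obtained the coordinates of every member
  converge, and \<open>T n\<close> is the passage to these coordinates.

  Given the charts, \<open>x \<mapsto> lim (\<lambda>n. T n (x n))\<close> identifies the pretangent space with \<open>\<complex>\<close>. For
  tangency, the extended family along a subsequence contains, for each \<open>z\<close>, the sequence with
  chart values constantly \<open>z\<close>. The chart values of any other member \<open>y\<close> thus have convergent
  distances to every point of the plane, so they converge to some \<open>z\<close> by trilateration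
  (\<open>convergent_if_dist_convergent\<close>), and the class of \<open>y\<close> is hit by the sequence with values \<open>z\<close>.
\<close>

section \<open>Isometries of pretangent spaces\<close>

lemma isometric_pretangent_if_isometric_family:
  fixes d :: "'b \<Rightarrow> 'b \<Rightarrow> real"
  assumes r: "normalizing_seq r" and F: "self_stable r F"
    and \<phi>: "\<phi> ` F = N"
    and d: "\<And>x y. x \<in> F \<Longrightarrow> y \<in> F \<Longrightarrow> d (\<phi> x) (\<phi> y) = lim_dist r x y"
    and d0: "\<And>u v. d u v = 0 \<Longrightarrow> u = v"
  shows "isometric_spaces (pretangent r F) (pretangent_dist r) N d"
proof -
  let ?R = "zero_dist_rel r F"
  define rep :: "(nat \<Rightarrow> 'a) set \<Rightarrow> nat \<Rightarrow> 'a" where "rep A = (SOME x. x \<in> A)" for A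
  have eq: "equiv F ?R" by (rule equiv_zero_dist_rel[OF r F])
  have rep: "rep A \<in> A" "rep A \<in> F" if A: "A \<in> pretangent r F" for A
  proof -
    have "A \<noteq> {}" "A \<subseteq> F"
      using in_quotient_imp_non_empty[OF eq] in_quotient_imp_subset[OF eq] A
      by (auto simp: pretangent_def)
    then show "rep A \<in> A" unfolding rep_def by (simp add: some_in_eq)
    then show "rep A \<in> F" using \<open>A \<subseteq> F\<close> by blast
  qed
  have "\<phi> x \<in> (\<lambda>A. \<phi> (rep A)) ` pretangent r F" if x: "x \<in> F" for x
  proof -
    define A where "A = ?R `` {x}"
    have A: "A \<in> pretangent r F" using x by (simp add: A_def pretangent_def quotientI)
    have "(x, rep A) \<in> ?R" using rep(1)[OF A] unfolding A_def by blast
    then have "lim_dist r x (rep A) = 0" by (simp add: zero_dist_rel_def)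
    then have "\<phi> x = \<phi> (rep A)" using d[OF x rep(2)[OF A]] d0 by simp
    then show ?thesis using A by (rule image_eqI)
  qed
  then have "(\<lambda>A. \<phi> (rep A)) ` pretangent r F = N" using rep(2) \<phi> by blast
  then have "isometry_between (pretangent r F) (pretangent_dist r) N d (\<lambda>A. \<phi> (rep A))"
    using d rep(2) by (simp add: isometry_between_def pretangent_dist_def rep_def)
  then show ?thesis unfolding isometric_spaces_def by blast
qed

text \<open>The map between the quotients always preserves distances, so only its surjectivity is at
  stake.\<close>

lemma tangent_if_subsequences_dense:
  assumes r: "normalizing_seq r" and F: "self_stable r F"
    and hit: "\<And>s F' y. strict_mono s \<Longrightarrow> max_stable_family a (r \<circ> s) F' \<Longrightarrow>
      (\<lambda>x. x \<circ> s) ` F \<subseteq> F' \<Longrightarrow> y \<in> F' \<Longrightarrow> \<exists>x\<in>F. lim_dist (r \<circ> s) (x \<circ> s) y = 0"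
  shows "tangent a r F"
  unfolding tangent_def
proof (intro allI impI)
  fix s F'
  assume s: "strict_mono s" and F'max: "max_stable_family a (r \<circ> s) F'"
    and sub: "(\<lambda>x. x \<circ> s) ` F \<subseteq> F'"
  let ?R = "zero_dist_rel r F" and ?R' = "zero_dist_rel (r \<circ> s) F'"
  let ?em = "subseq_map (r \<circ> s) F' s"
  have F': "self_stable (r \<circ> s) F'"
    using F'max by (simp add: max_stable_family_def maximal_self_stable_def)
  have r': "normalizing_seq (r \<circ> s)" by (rule normalizing_seq_subseq[OF r s])
  have eq': "equiv F' ?R'" by (rule equiv_zero_dist_rel[OF r' F'])
  have em: "?em (?R `` {x}) = ?R' `` {x \<circ> s}" if "x \<in> F" for x
    by (rule subseq_map_class[OF r s F F' sub that])
  have cls: "?R `` {x} \<in> pretangent r F" "x \<in> ?R `` {x}" if "x \<in> F" for x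
    using that by (simp_all add: pretangent_def quotientI) (simp add: zero_dist_rel_def)
  have cls': "?R' `` {y} \<in> pretangent (r \<circ> s) F'" "y \<in> ?R' `` {y}" if "y \<in> F'" for y
    using that by (simp_all add: pretangent_def quotientI) (simp add: zero_dist_rel_def)
  have mem: "x \<circ> s \<in> F'" if "x \<in> F" for x using that sub by blast
  have ex: "\<exists>x\<in>F. A = ?R `` {x}" if "A \<in> pretangent r F" for A
    using that by (auto simp: pretangent_def elim: quotientE)
  have "?em ` pretangent r F = pretangent (r \<circ> s) F'"
  proof (intro equalityI subsetI)
    fix B assume "B \<in> ?em ` pretangent r F"
    then show "B \<in> pretangent (r \<circ> s) F'" using ex em cls'(1) mem by fastforce
  next
    fix B assume "B \<in> pretangent (r \<circ> s) F'"
    then obtain y where y: "y \<in> F'" "B = ?R' `` {y}"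
      by (auto simp: pretangent_def elim: quotientE)
    obtain x where x: "x \<in> F" "lim_dist (r \<circ> s) (x \<circ> s) y = 0"
      using hit[OF s F'max sub y(1)] by blast
    have "(x \<circ> s, y) \<in> ?R'" using x y(1) mem by (simp add: zero_dist_rel_def)
    then have "?em (?R `` {x}) = B"
      using em[OF x(1)] equiv_class_eq[OF eq'] y(2) by simp
    then show "B \<in> ?em ` pretangent r F" using cls(1)[OF x(1)] by blast
  qed
  moreover have "pretangent_dist (r \<circ> s) (?em A) (?em B) = pretangent_dist r A B"
    if AB: "A \<in> pretangent r F" "B \<in> pretangent r F" for A B
  proof -
    obtain x y where x: "x \<in> F" "A = ?R `` {x}" and y: "y \<in> F" "B = ?R `` {y}"
      using ex AB by meson
    have "pretangent_dist (r \<circ> s) (?em A) (?em B) = lim_dist (r \<circ> s) (x \<circ> s) (y \<circ> s)"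
      using pretangent_dist_class[OF r' F' cls'[OF mem[OF x(1)]] cls'[OF mem[OF y(1)]]]
      by (simp add: x y em)
    also have "\<dots> = lim_dist r x y"
      using F x(1) y(1) by (intro lim_dist_subseq[OF _ s]) (simp add: self_stable_def)
    also have "\<dots> = pretangent_dist r A B"
      using pretangent_dist_class[OF r F cls[OF x(1)] cls[OF y(1)]] by (simp add: x y)
    finally show ?thesis .
  qed
  ultimately show "isometry_between (pretangent r F) (pretangent_dist r)
      (pretangent (r \<circ> s) F') (pretangent_dist (r \<circ> s)) ?em"
    by (simp add: isometry_between_def)
qed

section \<open>Families described by convergence in charts\<close>

text \<open>Trilateration: \<open>0\<close>, \<open>1\<close> and \<open>\<i>\<close> are not collinear, so the distances to them determine the
  coordinates, and do so continuously.\<close>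

lemma convergent_if_dist_convergent:
  fixes u :: "nat \<Rightarrow> complex"
  assumes "\<And>z. convergent (\<lambda>n. dist (u n) z)"
  shows "convergent u"
proof -
  have sq: "convergent (\<lambda>n. (dist (u n) z)\<^sup>2)" for z
    unfolding power2_eq_square by (intro convergent_mult assms)
  have Re: "Re w = ((dist w 0)\<^sup>2 - (dist w 1)\<^sup>2 + 1) * (1/2)"
    and Im: "Im w = ((dist w 0)\<^sup>2 - (dist w \<i>)\<^sup>2 + 1) * (1/2)" for w
    unfolding dist_norm cmod_power2 by (simp_all add: power2_eq_square algebra_simps)
  have "convergent (\<lambda>n. Re (u n))" "convergent (\<lambda>n. Im (u n))"
    unfolding Re Im
    by (intro convergent_mult convergent_add convergent_diff convergent_const sq)+
  then show ?thesis
    unfolding convergent_def by (auto simp: tendsto_complex_iff) (metis complex.sel)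
qed

text \<open>The factor \<open>1 / r n\<close> is part of the chart, so that the chart \<open>T n\<close> turns the rescaled
  distance into the Euclidean one.\<close>

definition convergence_charts ::
    "(nat \<Rightarrow> real) \<Rightarrow> (nat \<Rightarrow> 'a::metric_space) set \<Rightarrow> (nat \<Rightarrow> 'a \<Rightarrow> complex) \<Rightarrow> bool" where
  "convergence_charts r F T \<longleftrightarrow>
     (\<forall>n. surj (T n)) \<and> (\<forall>n x y. dist (T n x) (T n y) = dist x y / r n) \<and>
     F = {x. convergent (\<lambda>n. T n (x n))}"

lemma convergence_charts_constant_value:
  assumes "convergence_charts r F T"
  obtains x where "x \<in> F" "\<And>n. T n (x n) = z"
proof -
  have "\<forall>n. \<exists>p. T n p = z"
    using assms unfolding convergence_charts_def surj_def by metis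
  then obtain x where "\<And>n. T n (x n) = z" by metis
  moreover have "x \<in> F"
    using assms calculation by (simp add: convergence_charts_def convergent_const)
  ultimately show ?thesis using that by blast
qed

lemma isometric_complex_if_convergence_charts:
  assumes r: "normalizing_seq r" and F: "self_stable r F" and T: "convergence_charts r F T"
  shows "isometric_spaces (pretangent r F) (pretangent_dist r) (UNIV :: complex set) dist"
proof (rule isometric_pretangent_if_isometric_family[OF r F])
  let ?\<phi> = "\<lambda>x. lim (\<lambda>n. T n (x n))"
  have "z \<in> ?\<phi> ` F" for z
  proof -
    obtain x where "x \<in> F" "\<And>n. T n (x n) = z"
      using convergence_charts_constant_value[OF T] by blast
    then show ?thesis by (intro image_eqI[of _ _ x]) simp_all
  qed
  then show "?\<phi> ` F = UNIV" by blast
  fix x y assume "x \<in> F" "y \<in> F"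
  then have "(\<lambda>n. T n (x n)) \<longlonglongrightarrow> ?\<phi> x" "(\<lambda>n. T n (y n)) \<longlonglongrightarrow> ?\<phi> y"
    using T by (auto simp: convergence_charts_def convergent_LIMSEQ_iff)
  from tendsto_dist[OF this] show "dist (?\<phi> x) (?\<phi> y) = lim_dist r x y"
    using T by (simp add: convergence_charts_def lim_dist_def limI)
qed simp

lemma tangent_if_convergence_charts:
  assumes r: "normalizing_seq r" and F: "self_stable r F" and T: "convergence_charts r F T"
  shows "tangent a r F"
proof (rule tangent_if_subsequences_dense[OF r F])
  fix s F' y
  assume F': "max_stable_family a (r \<circ> s) F'"
    and sub: "(\<lambda>x. x \<circ> s) ` F \<subseteq> F'" and y: "y \<in> F'"
  have dT: "dist (T n u) (T n v) = dist u v / r n" for n u v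
    using T by (simp add: convergence_charts_def)
  have "convergent (\<lambda>n. dist (T (s n) (y n)) z)" for z
  proof -
    obtain x where x: "x \<in> F" "\<And>n. T n (x n) = z"
      using convergence_charts_constant_value[OF T] by blast
    have "convergent (\<lambda>n. dist (y n) (x (s n)) / r (s n))"
      using F' sub x(1) y
      by (fastforce simp: max_stable_family_def maximal_self_stable_def self_stable_def
          mutually_stable_def)
    then show ?thesis by (simp add: x(2) flip: dT)
  qed
  then have "convergent (\<lambda>n. T (s n) (y n))" by (rule convergent_if_dist_convergent)
  then obtain z where z: "(\<lambda>n. T (s n) (y n)) \<longlonglongrightarrow> z"
    unfolding convergent_def by blast
  obtain x where x: "x \<in> F" "\<And>n. T n (x n) = z"
    using convergence_charts_constant_value[OF T] by blast
  have "(\<lambda>n. dist (T (s n) (x (s n))) (T (s n) (y n))) \<longlonglongrightarrow> dist z z"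
    unfolding x(2) by (intro tendsto_intros z)
  then have "lim_dist (r \<circ> s) (x \<circ> s) y = 0"
    by (simp add: dT lim_dist_def limI)
  then show "\<exists>x\<in>F. lim_dist (r \<circ> s) (x \<circ> s) y = 0" using x(1) by blast
qed

section \<open>Inner products in stable families\<close>

lemma stable_family_norm_convergent:
  fixes F :: "(nat \<Rightarrow> 'a::real_normed_vector) set"
  assumes "max_stable_family 0 r F" "x \<in> F"
  shows "convergent (\<lambda>n. norm (x n) / r n)"
proof -
  have "mutually_stable r x (\<lambda>_. 0)"
    using assms by (simp add: max_stable_family_def maximal_self_stable_def self_stable_def)
  then show ?thesis by (simp add: mutually_stable_def)
qed

lemma stable_family_inner_convergent:
  fixes F :: "(nat \<Rightarrow> 'a::real_inner) set"
  assumes F: "max_stable_family 0 r F" and xy: "x \<in> F" "y \<in> F"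
  shows "convergent (\<lambda>n. (x n \<bullet> y n) / (r n)\<^sup>2)"
proof -
  have "convergent (\<lambda>n. dist (x n) (y n) / r n)"
    using assms by (simp add: max_stable_family_def maximal_self_stable_def self_stable_def
        mutually_stable_def)
  then have "convergent (\<lambda>n. ((norm (x n) / r n)\<^sup>2 + (norm (y n) / r n)\<^sup>2
      - (dist (x n) (y n) / r n)\<^sup>2) * (1/2))"
    unfolding power2_eq_square
    by (intro convergent_mult convergent_add convergent_diff convergent_const
        stable_family_norm_convergent[OF F] xy)
  also have "(\<lambda>n. ((norm (x n) / r n)\<^sup>2 + (norm (y n) / r n)\<^sup>2
      - (dist (x n) (y n) / r n)\<^sup>2) * (1/2)) = (\<lambda>n. (x n \<bullet> y n) / (r n)\<^sup>2)"
    by (simp add: dist_norm power_divide dot_norm_neg add_divide_distrib diff_divide_distrib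
        mult.commute)
  finally show ?thesis .
qed

text \<open>If all components along \<open>p n\<close> were to vanish in the limit, the sequence \<open>r n *\<^sub>R p n\<close> would
  asymptotically be orthogonal to the whole family. Pythagoras makes it mutually stable with all
  members, so it is a member itself; but its own component along \<open>p n\<close> is \<open>1\<close>.\<close>

lemma maximal_family_meets_direction:
  fixes F :: "(nat \<Rightarrow> 'a::real_inner) set"
  assumes r: "\<And>n. 0 < r n" and F: "max_stable_family 0 r F" and p: "\<And>n. norm (p n) = 1"
  shows "\<exists>y\<in>F. \<not> (\<lambda>n. (y n \<bullet> p n) / r n) \<longlonglongrightarrow> 0"
proof (rule ccontr)
  assume "\<not> ?thesis"
  then have 0: "(\<lambda>n. (y n \<bullet> p n) / r n) \<longlonglongrightarrow> 0" if "y \<in> F" for y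
    using that by blast
  define z where "z n = r n *\<^sub>R p n" for n
  have r0: "r n \<noteq> 0" for n using r[of n] by simp
  have "mutually_stable r z y" if y: "y \<in> F" for y
  proof -
    have pyth: "dist (z n) (y n) / r n
        = sqrt (1 - 2 * ((y n \<bullet> p n) / r n) + (norm (y n) / r n)\<^sup>2)" for n
    proof -
      have "(dist (z n) (y n))\<^sup>2 = (r n)\<^sup>2 - 2 * r n * (y n \<bullet> p n) + (norm (y n))\<^sup>2"
        using p[of n] unfolding dist_norm power2_norm_eq_inner
        by (simp add: z_def inner_diff inner_commute power2_eq_square norm_eq_1 algebra_simps)
      then have "(dist (z n) (y n) / r n)\<^sup>2
          = 1 - 2 * ((y n \<bullet> p n) / r n) + (norm (y n) / r n)\<^sup>2"
        using r0[of n] by (simp add: power_divide field_simps power2_eq_square)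
      then show ?thesis using r[of n] by (metis real_sqrt_unique zero_le_dist divide_nonneg_pos)
    qed
    obtain L where "(\<lambda>n. norm (y n) / r n) \<longlonglongrightarrow> L"
      using stable_family_norm_convergent[OF F y] unfolding convergent_def by blast
    then have "(\<lambda>n. dist (z n) (y n) / r n) \<longlonglongrightarrow> sqrt (1 - 2 * 0 + L\<^sup>2)"
      unfolding pyth by (intro tendsto_intros 0 y)
    then show ?thesis unfolding mutually_stable_def convergent_def by blast
  qed
  then have "z \<in> F" using F by (auto simp: max_stable_family_def maximal_self_stable_def)
  moreover have "(\<lambda>n. (z n \<bullet> p n) / r n) = (\<lambda>n. 1)"
    using p r0 by (simp add: z_def norm_eq_1)
  ultimately show False using 0[of z] by (simp only: LIMSEQ_const_iff) simp
qed

section \<open>The frames of a maximal family in the plane\<close>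

text \<open>A product whose second factor stays away from zero determines the first one up to the sign
  of the second.\<close>

lemma convergent_sign_times:
  fixes f g :: "nat \<Rightarrow> real"
  assumes fg: "convergent (\<lambda>n. f n * g n)" and g: "convergent (\<lambda>n. (g n)\<^sup>2)"
    and g0: "\<not> g \<longlonglongrightarrow> 0"
  shows "convergent (\<lambda>n. (if g n < 0 then - 1 else 1) * f n)"
proof -
  obtain M where M: "(\<lambda>n. f n * g n) \<longlonglongrightarrow> M" using fg unfolding convergent_def by blast
  obtain L where L: "(\<lambda>n. (g n)\<^sup>2) \<longlonglongrightarrow> L" using g unfolding convergent_def by blast
  from tendsto_real_sqrt[OF L] have absg: "(\<lambda>n. \<bar>g n\<bar>) \<longlonglongrightarrow> sqrt L" by simp
  have nz: "sqrt L \<noteq> 0" using absg g0 tendsto_rabs_zero_iff by metis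
  have "(\<lambda>n. f n * g n / \<bar>g n\<bar>) \<longlonglongrightarrow> M / sqrt L"
    by (rule tendsto_divide[OF M absg nz])
  moreover have "eventually (\<lambda>n. f n * g n / \<bar>g n\<bar> = (if g n < 0 then - 1 else 1) * f n) sequentially"
    using tendsto_imp_eventually_ne[OF absg nz] by eventually_elim auto
  ultimately show ?thesis by (rule convergentI[OF Lim_transform_eventually])
qed

lemma complex_inner_orthonormal_expansion:
  fixes w x y :: complex
  assumes "norm w = 1"
  shows "x \<bullet> y = (x \<bullet> w) * (y \<bullet> w) + (x \<bullet> (\<i> * w)) * (y \<bullet> (\<i> * w))"
proof -
  have "(Re w)\<^sup>2 + (Im w)\<^sup>2 = 1" using assms cmod_power2[of w] by simp
  moreover have "(x \<bullet> w) * (y \<bullet> w) + (x \<bullet> (\<i> * w)) * (y \<bullet> (\<i> * w))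
      = (x \<bullet> y) * ((Re w)\<^sup>2 + (Im w)\<^sup>2)"
    by (simp add: inner_complex_def power2_eq_square algebra_simps)
  ultimately show ?thesis by simp
qed

text \<open>A member that is nonzero in the limit exists, as otherwise no member would have a component
  along \<open>1\<close>. The directions of that member serve as \<open>w n\<close>: dividing the convergent inner products
  with it by its convergent norms gives the components along \<open>w n\<close>.\<close>

lemma maximal_family_direction:
  fixes F :: "(nat \<Rightarrow> complex) set"
  assumes r: "\<And>n. 0 < r n" and F: "max_stable_family 0 r F"
  obtains w where "\<And>n. norm (w n) = 1" "\<And>y. y \<in> F \<Longrightarrow> convergent (\<lambda>n. (y n \<bullet> w n) / r n)"
proof -
  obtain x where x: "x \<in> F" and x1: "\<not> (\<lambda>n. (x n \<bullet> 1) / r n) \<longlonglongrightarrow> 0"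
    using maximal_family_meets_direction[OF r F, of "\<lambda>_. 1"] norm_one by blast
  obtain L where L: "(\<lambda>n. norm (x n) / r n) \<longlonglongrightarrow> L"
    using stable_family_norm_convergent[OF F x] unfolding convergent_def by blast
  have L0: "L \<noteq> 0"
  proof
    assume "L = 0"
    have "\<forall>n. norm ((x n \<bullet> 1) / r n) \<le> norm (x n) / r n"
    proof
      show "norm ((x n \<bullet> 1) / r n) \<le> norm (x n) / r n" for n
        using r[of n] Cauchy_Schwarz_ineq2[of "x n" 1] by (simp add: divide_right_mono)
    qed
    from Lim_null_comparison[OF always_eventually[OF this] L[unfolded \<open>L = 0\<close>]]
    have "(\<lambda>n. (x n \<bullet> 1) / r n) \<longlonglongrightarrow> 0" .
    with x1 show False by simp
  qed
  \<comment> \<open>Any unit vector serves where \<open>x n\<close> vanishes, which happens only finitely often.\<close>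
  define w where "w n = (if x n = 0 then 1 else sgn (x n))" for n
  show thesis
  proof
    show "norm (w n) = 1" for n by (simp add: w_def norm_sgn)
    fix y assume y: "y \<in> F"
    obtain M where "(\<lambda>n. (y n \<bullet> x n) / (r n)\<^sup>2) \<longlonglongrightarrow> M"
      using stable_family_inner_convergent[OF F y x] unfolding convergent_def by blast
    from tendsto_divide[OF this L L0]
    have "(\<lambda>n. (y n \<bullet> x n) / (r n)\<^sup>2 / (norm (x n) / r n)) \<longlonglongrightarrow> M / L" .
    moreover have "eventually (\<lambda>n. (y n \<bullet> x n) / (r n)\<^sup>2 / (norm (x n) / r n) = (y n \<bullet> w n) / r n)
        sequentially"
      using tendsto_imp_eventually_ne[OF L L0]
    proof eventually_elim
      case (elim n)
      then have "x n \<noteq> 0" by auto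
      then show ?case using r[of n]
        by (simp add: w_def sgn_div_norm power2_eq_square divide_simps)
    qed
    ultimately show "convergent (\<lambda>n. (y n \<bullet> w n) / r n)"
      by (rule convergentI[OF Lim_transform_eventually])
  qed
qed

text \<open>With the directions \<open>w n\<close> at hand, the normal coordinates of members are known up to sign,
  since norms and tangential coordinates converge. A member whose normal coordinates do not vanish
  in the limit ties the signs of all the others to its own.\<close>

lemma maximal_family_normal_sign:
  fixes F :: "(nat \<Rightarrow> complex) set"
  assumes r: "\<And>n. 0 < r n" and F: "max_stable_family 0 r F"
    and w: "\<And>n. norm (w n) = 1"
    and wF: "\<And>y. y \<in> F \<Longrightarrow> convergent (\<lambda>n. (y n \<bullet> w n) / r n)"
  obtains e :: "nat \<Rightarrow> real" where "\<And>n. \<bar>e n\<bar> = 1"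
    "\<And>y. y \<in> F \<Longrightarrow> convergent (\<lambda>n. e n * ((y n \<bullet> (\<i> * w n)) / r n))"
proof -
  define h where "h y n = (y n \<bullet> (\<i> * w n)) / r n" for y n
  have "norm (\<i> * w n) = 1" for n by (simp add: norm_mult w)
  then obtain v where v: "v \<in> F" and v0: "\<not> h v \<longlonglongrightarrow> 0"
    using maximal_family_meets_direction[OF r F, of "\<lambda>n. \<i> * w n"] unfolding h_def by blast
  have prod: "convergent (\<lambda>n. h y n * h v n)" if y: "y \<in> F" for y
  proof -
    have "h y n * h v n = (y n \<bullet> v n) / (r n)\<^sup>2 - (y n \<bullet> w n) / r n * ((v n \<bullet> w n) / r n)" for n
      using complex_inner_orthonormal_expansion[OF w, of "y n" "v n" n]
      by (simp add: h_def power2_eq_square add_divide_distrib)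
    moreover have "convergent (\<lambda>n. (y n \<bullet> v n) / (r n)\<^sup>2
        - (y n \<bullet> w n) / r n * ((v n \<bullet> w n) / r n))"
      by (intro convergent_diff convergent_mult wF y v stable_family_inner_convergent[OF F])
    ultimately show ?thesis by simp
  qed
  show thesis
  proof (rule that)
    show "\<bar>if h v n < 0 then - 1 else 1 :: real\<bar> = 1" for n by simp
    show "convergent (\<lambda>n. (if h v n < 0 then - 1 else 1) * ((y n \<bullet> (\<i> * w n)) / r n))"
      if "y \<in> F" for y
      using convergent_sign_times[OF prod[OF that] _ v0] prod[OF v]
      by (simp add: h_def power2_eq_square)
  qed
qed

text \<open>Convergence in the charts holds for members by the choice of the frames. Conversely, a sequence
  that converges in the charts is mutually stable with all members, because the charts preserve the
  rescaled distances; maximality then makes it a member.\<close>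

theorem maximal_family_has_convergence_charts:
  fixes F :: "(nat \<Rightarrow> complex) set"
  assumes r: "\<And>n. 0 < r n" and F: "max_stable_family 0 r F"
  obtains T where "convergence_charts r F T"
proof -
  obtain w where w: "\<And>n. norm (w n) = 1"
    and wF: "\<And>y. y \<in> F \<Longrightarrow> convergent (\<lambda>n. (y n \<bullet> w n) / r n)"
    using maximal_family_direction[OF r F] by blast
  obtain e :: "nat \<Rightarrow> real" where e: "\<And>n. \<bar>e n\<bar> = 1"
    and eF: "\<And>y. y \<in> F \<Longrightarrow> convergent (\<lambda>n. e n * ((y n \<bullet> (\<i> * w n)) / r n))"
    using maximal_family_normal_sign[OF r F w wF] by blast
  have e2: "(e n)\<^sup>2 = 1" for n using e[of n] by (simp add: abs_square_eq_1)
  define T where "T n z = Complex ((z \<bullet> w n) / r n) (e n * ((z \<bullet> (\<i> * w n)) / r n))" for n z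
  have dT: "dist (T n x) (T n y) = dist x y / r n" for n x y
  proof -
    have "T n x - T n y = T n (x - y)"
      by (simp add: T_def complex_eq_iff inner_diff_left diff_divide_distrib right_diff_distrib)
    moreover have "(norm (T n z))\<^sup>2 = (norm z / r n)\<^sup>2" for z
      unfolding power_divide power2_norm_eq_inner[of z]
        complex_inner_orthonormal_expansion[OF w, of z z n]
      using e2[of n]
      by (simp add: T_def cmod_power2 power_mult_distrib power_divide add_divide_distrib
          flip: power2_eq_square)
    ultimately have "(dist (T n x) (T n y))\<^sup>2 = (dist x y / r n)\<^sup>2" by (simp add: dist_norm)
    then show ?thesis using r[of n] by (simp add: power2_eq_iff_nonneg less_imp_le)
  qed
  have "surj (T n)" for n
  proof (rule surjI)
    fix z
    have "w n \<bullet> w n = 1" "(\<i> * w n) \<bullet> (\<i> * w n) = 1"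
      using w[of n] by (simp_all add: norm_mult flip: power2_norm_eq_inner)
    moreover have "w n \<bullet> (\<i> * w n) = 0" "(\<i> * w n) \<bullet> w n = 0"
      by (simp_all add: inner_complex_def)
    moreover have "e n * e n = 1" using e2[of n] by (simp add: power2_eq_square)
    \<comment> \<open>The sign \<open>e n\<close> is its own inverse, so it also occurs in the inverse of \<open>T n\<close>.\<close>
    ultimately show "T n ((r n * Re z) *\<^sub>R w n + (r n * e n * Im z) *\<^sub>R (\<i> * w n)) = z"
      using r[of n] unfolding T_def complex_eq_iff
      by (simp add: inner_add_left)
  qed
  moreover have sub: "convergent (\<lambda>n. T n (y n))" if y: "y \<in> F" for y
  proof -
    obtain a b where "(\<lambda>n. (y n \<bullet> w n) / r n) \<longlonglongrightarrow> a"
      "(\<lambda>n. e n * ((y n \<bullet> (\<i> * w n)) / r n)) \<longlonglongrightarrow> b"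
      using wF[OF y] eF[OF y] unfolding convergent_def by blast
    from tendsto_Complex[OF this] show ?thesis unfolding T_def by (rule convergentI)
  qed
  moreover have "x \<in> F" if x: "convergent (\<lambda>n. T n (x n))" for x
  proof -
    obtain a where a: "(\<lambda>n. T n (x n)) \<longlonglongrightarrow> a" using x unfolding convergent_def by blast
    have "mutually_stable r x y" if y: "y \<in> F" for y
    proof -
      obtain b where "(\<lambda>n. T n (y n)) \<longlonglongrightarrow> b" using sub[OF y] unfolding convergent_def by blast
      from tendsto_dist[OF a this] show ?thesis
        unfolding dT mutually_stable_def by (rule convergentI)
    qed
    then show ?thesis using F unfolding max_stable_family_def maximal_self_stable_def by blast
  qed
  ultimately have "convergence_charts r F T" using dT unfolding convergence_charts_def by blast
  then show thesis by (rule that)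
qed

theorem proposition3p4:
  fixes r :: "nat \<Rightarrow> real" and F :: "(nat \<Rightarrow> complex) set"
  assumes "normalizing_seq r"
    and "max_stable_family 0 r F"
  shows "tangent 0 r F \<and>
    isometric_spaces (pretangent r F) (pretangent_dist r) (UNIV :: complex set) dist"
proof -
  have r: "0 < r n" for n using assms(1) by (simp add: normalizing_seq_def)
  have F: "self_stable r F"
    using assms(2) by (simp add: max_stable_family_def maximal_self_stable_def)
  obtain T where "convergence_charts r F T"
    using maximal_family_has_convergence_charts[OF r assms(2)] by blast
  then show ?thesis
    using tangent_if_convergence_charts[OF assms(1) F]
      isometric_complex_if_convergence_charts[OF assms(1) F] by blast
qed

end
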